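(* A marked vertex Gauss diagram is orientable if and only if for every chord $C$ the number of chord endpoints between the two endpoints of $C$ is even.
   Context: A marked vertex Gauss diagram encodes a virtual marked vertex diagram with a single naïve component, i.e. a diagram which is traced out by one closed curve when one passes straight through all crossings (classical, saddle and virtual). It consists of a circle with finitely many distinct marked points, joined in pairs: each classical crossing corresponds to an arrow joining the two points of the circle at which the crossing is traversed, directed toward the undercrossing point; each saddle crossing corresponds to an (undirected) chord joining the two points of the circle at which the saddle crossing is traversed, together with a marking indicating the direction of the saddle. Virtual crossings are not recorded. "Chord" refers only to saddle-crossing chords and "arrow" to classical crossings; "chord endpoints" are endpoints of chords, not of arrows. The semiarcs are the arcs of the circle between consecutive endpoints of chords or arrows (the whole circle if there are none). An orientation of a marked vertex Gauss diagram is a choice of direction for each semiarc such that: (pass-through rule) at each arrow endpoint, the two adjacent semiarcs are directed the same way around the circle; (source-sink rule) for each chord, at one of its two endpoints both adjacent semiarcs are directed toward the endpoint, and at its other endpoint both adjacent semiarcs are directed away from the endpoint. The diagram is orientable if it admits an orientation. The two endpoints of a chord $C$ divide the circle into two open arcs; "between the two endpoints of $C$" means lying in one of these arcs (since the total number of chord endpoints is even, the parity of the count does not depend on which arc is chosen). *)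

theory Defs
  imports Main "HOL-Library.FuncSet"
begin

text \<open>
  The marked points on the circle are numbered \<open>0, \<dots>, n - 1\<close> in the cyclic order in which they
  are met when going once around the circle from some base point.  An arrow carries its tail
  (overcrossing) and head (undercrossing) point.  A chord carries the unordered set of its two
  endpoints and its marking; nothing below depends on how saddle directions are encoded, so their
  type is a parameter \<open>'m\<close>.
\<close>

datatype 'm crossing = Arrow nat nat | Chord "nat set" 'm

primrec endpoints :: "'m crossing \<Rightarrow> nat set" where
  "endpoints (Arrow s t) = {s, t}"
| "endpoints (Chord P m) = P"

record 'm gauss_diagram =
  num_points :: nat
  crossings :: "'m crossing set"

definition marked_vertex_gauss_diagram :: "'m gauss_diagram \<Rightarrow> bool" where
  "marked_vertex_gauss_diagram D \<longleftrightarrow>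
     (\<forall>c\<in>crossings D. endpoints c \<subseteq> {..<num_points D} \<and> card (endpoints c) = 2) \<and>
     (\<forall>p<num_points D. \<exists>!c. c \<in> crossings D \<and> p \<in> endpoints c)"

definition arrows :: "'m gauss_diagram \<Rightarrow> 'm crossing set" where
  "arrows D = {c \<in> crossings D. \<exists>s t. c = Arrow s t}"

definition chords :: "'m gauss_diagram \<Rightarrow> 'm crossing set" where
  "chords D = {c \<in> crossings D. \<exists>P m. c = Chord P m}"

definition chord_endpoints :: "'m gauss_diagram \<Rightarrow> nat set" where
  "chord_endpoints D = (\<Union>C\<in>chords D. endpoints C)"

text \<open>
  Semiarc \<open>i\<close> runs from point \<open>i\<close> to the cyclically next point; without marked points the whole
  circle is the single semiarc \<open>0\<close>.
\<close>

definition semiarcs :: "'m gauss_diagram \<Rightarrow> nat set" where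
  "semiarcs D = (if num_points D = 0 then {0} else {..<num_points D})"

definition semiarc_before :: "'m gauss_diagram \<Rightarrow> nat \<Rightarrow> nat" where
  "semiarc_before D p = (if p = 0 then num_points D - 1 else p - 1)"

definition semiarc_after :: "'m gauss_diagram \<Rightarrow> nat \<Rightarrow> nat" where
  "semiarc_after D p = p"

text \<open>\<open>Forward\<close> is the direction around the circle in which the points are numbered.\<close>

datatype direction = Forward | Backward

definition both_towards :: "'m gauss_diagram \<Rightarrow> (nat \<Rightarrow> direction) \<Rightarrow> nat \<Rightarrow> bool" where
  "both_towards D \<omega> p \<longleftrightarrow>
     \<omega> (semiarc_before D p) = Forward \<and> \<omega> (semiarc_after D p) = Backward"

definition both_away :: "'m gauss_diagram \<Rightarrow> (nat \<Rightarrow> direction) \<Rightarrow> nat \<Rightarrow> bool" where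
  "both_away D \<omega> p \<longleftrightarrow>
     \<omega> (semiarc_before D p) = Backward \<and> \<omega> (semiarc_after D p) = Forward"

definition pass_through_rule :: "'m gauss_diagram \<Rightarrow> (nat \<Rightarrow> direction) \<Rightarrow> bool" where
  "pass_through_rule D \<omega> \<longleftrightarrow>
     (\<forall>a\<in>arrows D. \<forall>p\<in>endpoints a. \<omega> (semiarc_before D p) = \<omega> (semiarc_after D p))"

definition source_sink_rule :: "'m gauss_diagram \<Rightarrow> (nat \<Rightarrow> direction) \<Rightarrow> bool" where
  "source_sink_rule D \<omega> \<longleftrightarrow>
     (\<forall>C\<in>chords D. \<exists>p q. endpoints C = {p, q} \<and> both_towards D \<omega> p \<and> both_away D \<omega> q)"

definition orientation :: "'m gauss_diagram \<Rightarrow> (nat \<Rightarrow> direction) \<Rightarrow> bool" where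
  "orientation D \<omega> \<longleftrightarrow>
     \<omega> \<in> semiarcs D \<rightarrow>\<^sub>E UNIV \<and> pass_through_rule D \<omega> \<and> source_sink_rule D \<omega>"

definition orientable :: "'m gauss_diagram \<Rightarrow> bool" where
  "orientable D \<longleftrightarrow> (\<exists>\<omega>. orientation D \<omega>)"

text \<open>
  The marked points met strictly between \<open>p\<close> and \<open>q\<close> when going forward from \<open>p\<close>.  The two open
  arcs cut out by \<open>p \<noteq> q\<close> are \<open>open_arc D p q\<close> and \<open>open_arc D q p\<close>.
\<close>

definition open_arc :: "'m gauss_diagram \<Rightarrow> nat \<Rightarrow> nat \<Rightarrow> nat set" where
  "open_arc D p q = (if p < q then {p<..<q} else {p<..<num_points D} \<union> {..<q})"

lemma finite_chord_endpoints:
  assumes "marked_vertex_gauss_diagram D"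
  shows "finite (chord_endpoints D)"
proof (rule finite_subset)
  show "chord_endpoints D \<subseteq> {..<num_points D}"
    using assms
    unfolding marked_vertex_gauss_diagram_def chord_endpoints_def chords_def by blast
qed simp

lemma even_card_chord_endpoints:
  assumes D: "marked_vertex_gauss_diagram D"
  shows "even (card (chord_endpoints D))"
proof -
  let ?P = "endpoints ` chords D"
  have two: "card X = 2" if "X \<in> ?P" for X
    using D that unfolding marked_vertex_gauss_diagram_def chords_def by auto
  have disj: "X = Y" if "X \<in> ?P" "Y \<in> ?P" "x \<in> X" "x \<in> Y" for X Y x
    using D that unfolding marked_vertex_gauss_diagram_def chords_def
    by (smt (verit) image_iff lessThan_iff mem_Collect_eq subsetD)
  have "card (\<Union> ?P) = sum card ?P"
  proof (rule card_Union_disjoint)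
    show "pairwise disjnt ?P"
      unfolding pairwise_def disjnt_def using disj by blast
    show "finite X" if "X \<in> ?P" for X
      using two[OF that] by (simp add: card_ge_0_finite)
  qed
  also have "\<dots> = (\<Sum>X\<in>?P. 2)"
    by (rule sum.cong) (use two in auto)
  finally show ?thesis
    by (simp add: chord_endpoints_def)
qed

text \<open>The parity of the number of chord endpoints between \<open>p\<close> and \<open>q\<close> is the same for both arcs.\<close>

lemma even_open_arc_swap:
  assumes D: "marked_vertex_gauss_diagram D"
    and C: "C \<in> chords D" "endpoints C = {p, q}"
  shows "even (card (chord_endpoints D \<inter> open_arc D p q)) \<longleftrightarrow>
         even (card (chord_endpoints D \<inter> open_arc D q p))"
proof -
  let ?E = "chord_endpoints D"
  let ?A = "?E \<inter> open_arc D p q" and ?B = "?E \<inter> open_arc D q p"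
  have pq: "p < num_points D" "q < num_points D" "p \<noteq> q"
    using D C unfolding marked_vertex_gauss_diagram_def chords_def by (force, force, force)
  have sub: "?E \<subseteq> {..<num_points D}"
    using D unfolding marked_vertex_gauss_diagram_def chord_endpoints_def chords_def by blast
  have inE: "p \<in> ?E" "q \<in> ?E"
    using C unfolding chord_endpoints_def by auto
  have fin: "finite ?E" by (rule finite_chord_endpoints[OF D])
  have E: "?E = {p, q} \<union> (?A \<union> ?B)"
    using sub inE pq unfolding open_arc_def by (auto split: if_splits)
  have "{p, q} \<inter> (?A \<union> ?B) = {}" "?A \<inter> ?B = {}"
    using pq unfolding open_arc_def by (auto split: if_splits)
  then have "card ({p, q} \<union> (?A \<union> ?B)) = 2 + (card ?A + card ?B)"
    using fin pq by (simp add: card_Un_disjoint del: Un_insert_left)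
  then have "card ?E = 2 + (card ?A + card ?B)"
    using E by simp
  then show ?thesis
    using even_card_chord_endpoints[OF D] by simp
qed

end

theory Submission
  imports Defs
begin

text \<open>
  The pass-through rule lets the direction persist at arrow endpoints, while the source-sink rule
  makes it reverse at chord endpoints.  Directions that reverse at exactly the chord endpoints
  always exist, because the total number of chord endpoints is even, and the directions of two
  semiarcs agree iff an even number of chord endpoints separates them
  (\<open>same_direction_iff_even\<close>, \<open>ex_reversing_directions\<close>).

  What the source-sink rule demands beyond reversal is that one endpoint of each chord be a sink and
  the other one a source, rather than both of the same kind.  For endpoints \<open>p < q\<close> this says
  that the semiarc leaving \<open>p\<close> and the semiarc entering \<open>q\<close> have the same direction, that is, that
  the number of chord endpoints between \<open>p\<close> and \<open>q\<close> is even.  Hence under the parity condition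
  any such choice of directions is an orientation, and without it none is.
\<close>

definition reverses_at_chord_endpoints :: "'m gauss_diagram \<Rightarrow> (nat \<Rightarrow> direction) \<Rightarrow> bool" where
  "reverses_at_chord_endpoints D \<omega> \<longleftrightarrow>
     (\<forall>p<num_points D. \<omega> (semiarc_before D p) \<noteq> \<omega> (semiarc_after D p) \<longleftrightarrow> p \<in> chord_endpoints D)"

lemma chord_endpoints_lt:
  assumes "marked_vertex_gauss_diagram D" "p \<in> chord_endpoints D"
  shows "p < num_points D"
  using assms unfolding marked_vertex_gauss_diagram_def chord_endpoints_def chords_def by blast

lemma arrow_endpoint_not_chord_endpoint:
  assumes D: "marked_vertex_gauss_diagram D"
    and a: "a \<in> arrows D" "p \<in> endpoints a"
  shows "p \<notin> chord_endpoints D"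
proof
  assume "p \<in> chord_endpoints D"
  then obtain C where C: "C \<in> chords D" "p \<in> endpoints C"
    unfolding chord_endpoints_def by blast
  have "p < num_points D"
    using chord_endpoints_lt[OF D \<open>p \<in> chord_endpoints D\<close>] .
  then have "a = C"
    using D a C unfolding marked_vertex_gauss_diagram_def arrows_def chords_def by blast
  then show False
    using a C unfolding arrows_def chords_def by auto
qed

lemma arrow_or_chord_endpoint:
  assumes "marked_vertex_gauss_diagram D" "p < num_points D"
  obtains a where "a \<in> arrows D" "p \<in> endpoints a" | "p \<in> chord_endpoints D"
proof -
  obtain c where c: "c \<in> crossings D" "p \<in> endpoints c"
    using assms unfolding marked_vertex_gauss_diagram_def by blast
  show thesis
  proof (cases c)
    case (Arrow s t)
    then show thesis using c that(1) unfolding arrows_def by blast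
  next
    case (Chord P m)
    then show thesis using c that(2) unfolding chord_endpoints_def chords_def by blast
  qed
qed

lemma chord_ordered_endpoints:
  assumes D: "marked_vertex_gauss_diagram D" and C: "C \<in> chords D"
  obtains p q where "p < q" "q < num_points D" "endpoints C = {p, q}"
proof -
  have "card (endpoints C) = 2" and sub: "endpoints C \<subseteq> {..<num_points D}"
    using D C unfolding marked_vertex_gauss_diagram_def chords_def by auto
  then obtain x y where xy: "endpoints C = {x, y}" "x \<noteq> y"
    by (auto simp: card_2_iff)
  show thesis
  proof (cases "x < y")
    case True
    then show thesis using that[of x y] xy sub by auto
  next
    case False
    then show thesis using that[of y x] xy sub by auto
  qed
qed

text \<open>It is enough to count along the arc that avoids the base point of the numbering.\<close>

lemma even_between_iff:
  assumes D: "marked_vertex_gauss_diagram D" and C: "C \<in> chords D"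
    and pq: "endpoints C = {p, q}" "p < q"
  shows "(\<forall>x y. endpoints C = {x, y} \<longrightarrow> even (card (chord_endpoints D \<inter> open_arc D x y))) \<longleftrightarrow>
         even (card (chord_endpoints D \<inter> {p<..<q}))"
proof -
  have "open_arc D p q = {p<..<q}"
    using pq unfolding open_arc_def by simp
  then show ?thesis
    using even_open_arc_swap[OF D C pq(1)] pq(1) by (auto simp: doubleton_eq_iff)
qed

lemma orientation_reverses:
  assumes D: "marked_vertex_gauss_diagram D" and \<omega>: "orientation D \<omega>"
  shows "reverses_at_chord_endpoints D \<omega>"
  unfolding reverses_at_chord_endpoints_def
proof (intro allI impI)
  fix p assume p: "p < num_points D"
  show "\<omega> (semiarc_before D p) \<noteq> \<omega> (semiarc_after D p) \<longleftrightarrow> p \<in> chord_endpoints D"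
    using D p
  proof (cases rule: arrow_or_chord_endpoint)
    case (1 a)
    then show ?thesis
      using \<omega> arrow_endpoint_not_chord_endpoint[OF D 1]
      unfolding orientation_def pass_through_rule_def by auto
  next
    case 2
    then obtain C where C: "C \<in> chords D" "p \<in> endpoints C"
      unfolding chord_endpoints_def by blast
    then obtain x y where "endpoints C = {x, y}" "both_towards D \<omega> x" "both_away D \<omega> y"
      using \<omega> unfolding orientation_def source_sink_rule_def by blast
    then show ?thesis
      using 2 C unfolding both_towards_def both_away_def by auto
  qed
qed

lemma same_direction_iff_even:
  assumes \<omega>: "reverses_at_chord_endpoints D \<omega>" and "i \<le> j" "j < num_points D"
  shows "\<omega> i = \<omega> j \<longleftrightarrow> even (card (chord_endpoints D \<inter> {i<..j}))"
  using assms(2,3)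
proof (induction j rule: dec_induct)
  case base
  show ?case by simp
next
  case (step j)
  have "\<omega> j \<noteq> \<omega> (Suc j) \<longleftrightarrow> Suc j \<in> chord_endpoints D"
    using \<omega> step.prems
    unfolding reverses_at_chord_endpoints_def semiarc_before_def semiarc_after_def
    by force
  moreover have "{i<..Suc j} = insert (Suc j) {i<..j}"
    using step.hyps by auto
  \<comment> \<open>Having only two directions, two reversals cancel.\<close>
  ultimately show ?case
    using step.IH step.prems
    by (cases "\<omega> i"; cases "\<omega> j"; cases "\<omega> (Suc j)") auto
qed

text \<open>
  Once directions reverse at both ends \<open>p < q\<close> of a chord, each end is a source or a sink,
  and the two ends are of opposite kinds iff the semiarc leaving \<open>p\<close> agrees with the one entering
  \<open>q\<close>.
\<close>

lemma source_sink_iff_even: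
  assumes \<omega>: "reverses_at_chord_endpoints D \<omega>"
    and C: "C \<in> chords D" "endpoints C = {p, q}"
    and pq: "p < q" "q < num_points D"
  shows "(\<exists>x y. endpoints C = {x, y} \<and> both_towards D \<omega> x \<and> both_away D \<omega> y) \<longleftrightarrow>
         even (card (chord_endpoints D \<inter> {p<..<q}))"
proof -
  have "p \<in> chord_endpoints D" "q \<in> chord_endpoints D"
    using C unfolding chord_endpoints_def by auto
  then have rev: "\<omega> (semiarc_before D p) \<noteq> \<omega> (semiarc_after D p)"
      "\<omega> (semiarc_before D q) \<noteq> \<omega> (semiarc_after D q)"
    using \<omega> pq unfolding reverses_at_chord_endpoints_def by auto
  have "(\<exists>x y. endpoints C = {x, y} \<and> both_towards D \<omega> x \<and> both_away D \<omega> y) \<longleftrightarrow>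
        both_towards D \<omega> p \<and> both_away D \<omega> q \<or> both_towards D \<omega> q \<and> both_away D \<omega> p"
    unfolding C(2) by (auto simp: doubleton_eq_iff)
  also have "\<dots> \<longleftrightarrow> \<omega> (semiarc_after D p) = \<omega> (semiarc_before D q)"
    using rev unfolding both_towards_def both_away_def
    by (cases "\<omega> (semiarc_before D p)"; cases "\<omega> (semiarc_after D p)";
        cases "\<omega> (semiarc_before D q)"; cases "\<omega> (semiarc_after D q)") simp_all
  also have "\<dots> \<longleftrightarrow> \<omega> p = \<omega> (q - 1)"
    using pq unfolding semiarc_before_def semiarc_after_def by auto
  also have "\<dots> \<longleftrightarrow> even (card (chord_endpoints D \<inter> {p<..q - 1}))"
    using same_direction_iff_even[OF \<omega>, of p "q - 1"] pq by simp
  also have "{p<..q - 1} = {p<..<q}"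
    using pq by auto
  finally show ?thesis .
qed

lemma ex_reversing_directions:
  assumes D: "marked_vertex_gauss_diagram D"
  obtains \<omega> where "\<omega> \<in> semiarcs D \<rightarrow>\<^sub>E UNIV" "reverses_at_chord_endpoints D \<omega>"
proof -
  let ?E = "chord_endpoints D"
  let ?n = "num_points D"
  define dir where "dir i = (if even (card (?E \<inter> {..i})) then Forward else Backward)" for i
  define \<omega> where "\<omega> = restrict dir (semiarcs D)"
  have "reverses_at_chord_endpoints D \<omega>"
    unfolding reverses_at_chord_endpoints_def
  proof (intro allI impI)
    fix p assume p: "p < ?n"
    then have \<omega>_dir: "\<omega> (semiarc_before D p) = dir (semiarc_before D p)"
        "\<omega> (semiarc_after D p) = dir p"
      unfolding \<omega>_def semiarcs_def semiarc_before_def semiarc_after_def by auto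
    have "dir (semiarc_before D p) \<noteq> dir p \<longleftrightarrow> p \<in> ?E"
    proof (cases p)
      \<comment> \<open>At the base point the circle closes up; this is where an odd total would be an obstacle.\<close>
      case 0
      have "?E \<inter> {..?n - 1} = ?E"
        using chord_endpoints_lt[OF D] by fastforce
      then have "dir (?n - 1) = Forward"
        using even_card_chord_endpoints[OF D] unfolding dir_def by simp
      then show ?thesis
        using 0 unfolding semiarc_before_def
        by (cases "0 \<in> ?E") (simp_all add: dir_def)
    next
      case (Suc r)
      then show ?thesis
        unfolding semiarc_before_def
        by (cases "Suc r \<in> ?E") (simp_all add: dir_def atMost_Suc)
    qed
    then show "\<omega> (semiarc_before D p) \<noteq> \<omega> (semiarc_after D p) \<longleftrightarrow> p \<in> ?E"
      unfolding \<omega>_dir .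
  qed
  moreover have "\<omega> \<in> semiarcs D \<rightarrow>\<^sub>E UNIV"
    unfolding \<omega>_def by simp
  ultimately show thesis
    using that by blast
qed

theorem proposition7:
  fixes D :: "'m gauss_diagram"
  assumes "marked_vertex_gauss_diagram D"
  shows "orientable D \<longleftrightarrow>
    (\<forall>C\<in>chords D. \<forall>p q. endpoints C = {p, q} \<longrightarrow>
       even (card (chord_endpoints D \<inter> open_arc D p q)))"
proof -
  note D = assms
  have source_sink: "source_sink_rule D \<omega> \<longleftrightarrow>
      (\<forall>C\<in>chords D. \<forall>p q. endpoints C = {p, q} \<longrightarrow>
         even (card (chord_endpoints D \<inter> open_arc D p q)))"
    if \<omega>: "reverses_at_chord_endpoints D \<omega>" for \<omega>
    unfolding source_sink_rule_def
  proof (rule ball_cong[OF refl])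
    fix C assume C: "C \<in> chords D"
    obtain p q where pq: "p < q" "q < num_points D" "endpoints C = {p, q}"
      using chord_ordered_endpoints[OF D C] .
    show "(\<exists>x y. endpoints C = {x, y} \<and> both_towards D \<omega> x \<and> both_away D \<omega> y) \<longleftrightarrow>
        (\<forall>x y. endpoints C = {x, y} \<longrightarrow> even (card (chord_endpoints D \<inter> open_arc D x y)))"
      using source_sink_iff_even[OF \<omega> C pq(3,1,2)] even_between_iff[OF D C pq(3,1)] by simp
  qed
  show ?thesis
  proof
    assume "orientable D"
    then obtain \<omega> where "orientation D \<omega>"
      unfolding orientable_def by blast
    then show "\<forall>C\<in>chords D. \<forall>p q. endpoints C = {p, q} \<longrightarrow>
        even (card (chord_endpoints D \<inter> open_arc D p q))"
      using source_sink[OF orientation_reverses[OF D]] unfolding orientation_def by blast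
  next
    assume even: "\<forall>C\<in>chords D. \<forall>p q. endpoints C = {p, q} \<longrightarrow>
        even (card (chord_endpoints D \<inter> open_arc D p q))"
    obtain \<omega> where \<omega>: "\<omega> \<in> semiarcs D \<rightarrow>\<^sub>E UNIV" "reverses_at_chord_endpoints D \<omega>"
      using ex_reversing_directions[OF D] .
    have "pass_through_rule D \<omega>"
      unfolding pass_through_rule_def
    proof (intro ballI)
      fix a p assume a: "a \<in> arrows D" "p \<in> endpoints a"
      then have "p < num_points D"
        using D unfolding marked_vertex_gauss_diagram_def arrows_def by blast
      then show "\<omega> (semiarc_before D p) = \<omega> (semiarc_after D p)"
        using \<omega>(2) arrow_endpoint_not_chord_endpoint[OF D a]
        unfolding reverses_at_chord_endpoints_def by blast
    qed
    then show "orientable D"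
      using \<omega> source_sink even unfolding orientable_def orientation_def by blast
  qed
qed

end
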